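(* Consider the joint DRCCP with left-hand side uncertainty $\min_{x\in\mathcal X}\{c^\top x:\mathbb{P}_\zeta\{\theta\|x\|_*+x^\top\tilde\zeta_i\le b_i,\ \forall i\in[I]\}\ge1-\varepsilon\}$, i.e. with affine mappings $a_i(x)=x$ and $b_i(x)=b_i$ (constants) for each $i\in[I]$. Suppose that the deterministic set $\mathcal X\subseteq\mathbb{R}^n$ is convex, $\|\cdot\|_*=\|\cdot\|_p$ with $p\in(1,\infty)$, and the random parameter vector is $\tilde\zeta=[\tilde\zeta_1,\dots,\tilde\zeta_I]$, where the blocks $\tilde\zeta_i\in\mathbb{R}^n$ and $\tilde\zeta_j\in\mathbb{R}^n$ do not overlap for $i\ne j$, with reference distribution $\mathbb{P}_\zeta$ that is continuous and nondegenerate with full support $\mathbb{R}^{nI}$. Then the lower-level ALSO-X problem $$v^A(t)=\min_{x\in\mathcal X}\Big\{\mathbb{E}_{\mathbb{P}_\zeta}\Big[\max_{i\in[I]}\big(\theta\|x\|_*+x^\top\tilde\zeta_i-b_i\big)_+\Big] : c^\top x\le t\Big\}$$ admits a unique optimal solution when $t\ge\min_{x\in\mathcal X}c^\top x$ and $v^A(t)>0$.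
   Context: $[I]=\{1,\dots,I\}$, $c\in\mathbb{R}^n$, $b_i\in\mathbb{R}$, $\varepsilon\in(0,1)$, $\theta\ge0$, $(y)_+=\max\{y,0\}$; $\|\cdot\|_p$ is the $\ell_p$ norm on $\mathbb{R}^n$. "Do not overlap" means that distinct blocks consist of distinct coordinates of the random vector $\tilde\zeta\in\mathbb{R}^{nI}$. $\mathbb{P}_\zeta$ is assumed throughout to be sub-Gaussian: $\mathbb{P}_\zeta\{\|\tilde\zeta\|\ge\tau\}\le C_1\exp(-C_2\tau^2)$ for some constants $C_1,C_2>0$. "Continuous" means possessing a probability density; "nondegenerate" means not supported in a proper affine subspace. Convention: the minimization problem is understood to attain its minimum whenever it is feasible. *)

theory Defs
  imports "HOL-Probability.Probability"
begin

definition lp_norm :: "real \<Rightarrow> real ^ 'n \<Rightarrow> real" where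
  "lp_norm p x = (\<Sum>k\<in>UNIV. \<bar>x $ k\<bar> powr p) powr (1 / p)"

definition sub_gaussian :: "'a::euclidean_space measure \<Rightarrow> bool" where
  "sub_gaussian P \<longleftrightarrow>
     (\<exists>C1>0. \<exists>C2>0. \<forall>\<tau>\<ge>0. measure P {z. \<tau> \<le> norm z} \<le> C1 * exp (- C2 * \<tau>\<^sup>2))"

definition has_density :: "'a::euclidean_space measure \<Rightarrow> bool" where
  "has_density P \<longleftrightarrow> (\<exists>f\<in>borel_measurable lborel. P = density lborel f)"

definition nondegenerate :: "'a::euclidean_space measure \<Rightarrow> bool" where
  "nondegenerate P \<longleftrightarrow> \<not> (\<exists>A. affine A \<and> A \<noteq> UNIV \<and> (AE z in P. z \<in> A))"

definition topological_support :: "'a::topological_space measure \<Rightarrow> 'a set" where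
  "topological_support P = {z. \<forall>U. open U \<and> z \<in> U \<longrightarrow> 0 < emeasure P U}"

text \<open>
  A minimum value is taken in the extended reals, so that it is \<open>\<infinity>\<close> for an infeasible problem
  and \<open>-\<infinity>\<close> for an unbounded one. The convention that minima are attained is the separate
  predicate \<open>attains_min\<close>; it asks nothing of problems that are infeasible or unbounded below
  (an objective that is nonnegative, such as \<open>alsox_objective\<close>, is never unbounded below).
\<close>

definition min_value :: "('a \<Rightarrow> real) \<Rightarrow> 'a set \<Rightarrow> ereal" where
  "min_value h S = (INF x\<in>S. ereal (h x))"

definition attains_min :: "('a \<Rightarrow> real) \<Rightarrow> 'a set \<Rightarrow> bool" where
  "attains_min h S \<longleftrightarrow>
     (S \<noteq> {} \<and> bdd_below (h ` S) \<longrightarrow> (\<exists>x. is_arg_min h (\<lambda>x. x \<in> S) x))"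

text \<open>
  With \<open>n = CARD('n)\<close> and \<open>I = CARD('i)\<close>, the space \<open>\<real>\<^sup>n\<^sup>I\<close> is the type \<open>(real ^ 'n) ^ 'i\<close>: the
  \<open>i\<close>-th block of \<open>z\<close> is \<open>z $ i\<close>, its coordinates are \<open>z $ i $ k\<close>. Hence distinct blocks consist of
  distinct coordinates of \<open>z\<close>. No independence between blocks is implied: \<open>P\<close> is an arbitrary
  joint distribution.
\<close>

definition alsox_objective ::
  "((real ^ 'n) ^ 'i) measure \<Rightarrow> real \<Rightarrow> real \<Rightarrow> ('i \<Rightarrow> real) \<Rightarrow> real ^ 'n \<Rightarrow> real" where
  "alsox_objective P p \<theta> b x =
     prob_space.expectation P
       (\<lambda>z. MAX i\<in>UNIV. max (\<theta> * lp_norm p x + x \<bullet> (z $ i) - b i) 0)"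

definition alsox_feasible :: "(real ^ 'n) set \<Rightarrow> real ^ 'n \<Rightarrow> real \<Rightarrow> (real ^ 'n) set" where
  "alsox_feasible X c t = {x \<in> X. c \<bullet> x \<le> t}"

definition alsox_value ::
  "((real ^ 'n) ^ 'i) measure \<Rightarrow> real \<Rightarrow> real \<Rightarrow> ('i \<Rightarrow> real) \<Rightarrow> (real ^ 'n) set \<Rightarrow> real ^ 'n
     \<Rightarrow> real \<Rightarrow> ereal" where
  "alsox_value P p \<theta> b X c t = min_value (alsox_objective P p \<theta> b) (alsox_feasible X c t)"

end

theory Submission
  imports Defs "HOL-Real_Asymp.Real_Asymp"
begin

text \<open>
  Write \<open>f\<^sub>i(x, z) = \<theta> \<parallel>x\<parallel>\<^sub>p + x \<bullet> z\<^sub>i - b\<^sub>i\<close> for the violation of constraint \<open>i\<close> and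
  \<open>L(x, z) = max\<^sub>i (f\<^sub>i(x, z))\<^sub>+\<close> for the loss whose expectation is minimized. Minkowski's inequality
  makes every \<open>f\<^sub>i(\<cdot>, z)\<close> convex, hence \<open>L(\<cdot>, z)\<close> too. Suppose that \<open>x \<noteq> y\<close> are both
  optimal. Their midpoint is feasible, so its expected loss is at least the common optimal value,
  and the midpoint convexity of \<open>L\<close> must be an equality almost surely.

  Call \<open>z\<close> separating for \<open>(x, y)\<close> if \<open>x\<close> violates some constraint at \<open>z\<close> and \<open>y\<close> satisfies
  all of them with slack. Taking the positive part discards the slack of \<open>y\<close>, so midpoint convexity is
  strict at a separating \<open>z\<close> (lemma \<open>loss_midpoint_strict\<close>). Separating scenarios form an open set,
  which has positive probability by full support as soon as it is nonempty. So no scenario separates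
  \<open>x\<close> from \<open>y\<close> or \<open>y\<close> from \<open>x\<close>.

  Because the blocks \<open>z\<^sub>i\<close> can be chosen freely, this is very restrictive (lemma
  \<open>separating_or_proportional\<close>). Vectors that do not lie on a common ray from the origin are
  separated by a large multiple of a vector at an acute angle to \<open>x\<close> and an obtuse one to \<open>y\<close>. If,
  up to exchanging the two points, \<open>y = \<mu> x\<close> with \<open>x \<noteq> 0\<close> and \<open>0 \<le> \<mu> \<noteq> 1\<close>,
  then \<open>f\<^sub>i(x, z) = u\<^sub>i - b\<^sub>i\<close> and \<open>f\<^sub>i(y, z) = \<mu> u\<^sub>i - b\<^sub>i\<close> for freely chosen \<open>u\<^sub>i\<close>, and a separating choice exists unless \<open>L(y, \<cdot>) = \<mu> L(x, \<cdot>)\<close>. In this last case the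
  optimal value \<open>v\<close> satisfies \<open>v = \<mu> v\<close>, which \<open>v > 0\<close> and \<open>\<mu> \<noteq> 1\<close> exclude.
\<close>

section \<open>The \<open>\<ell>\<^sub>p\<close> norm\<close>

lemma powr_convex_combination:
  fixes p u v a b :: real
  assumes "1 < p" "0 \<le> u" "0 \<le> v" "u + v = 1" "0 \<le> a" "0 \<le> b"
  shows "(u * a + v * b) powr p \<le> u * a powr p + v * b powr p"
proof -
  \<comment> \<open>\<open>powr_convex\<close> is about the open half-line, so a zero argument needs its own bound.\<close>
  have shrink: "(w * d) powr p \<le> w * d powr p" if "0 \<le> w" "w \<le> 1" "0 \<le> d" for w d :: real
  proof -
    have "w powr p \<le> w"
      using that \<open>1 < p\<close> powr_mono'[of 1 p w] by simp
    then show ?thesis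
      using that by (simp add: powr_mult mult_right_mono)
  qed
  consider "a = 0" | "b = 0" | "0 < a" "0 < b"
    using assms by linarith
  then show ?thesis
  proof cases
    case 1
    then show ?thesis using shrink[of v b] assms by simp
  next
    case 2
    then show ?thesis using shrink[of u a] assms by simp
  next
    case 3
    then show ?thesis
      using powr_convex[of p] assms unfolding convex_on_def by simp
  qed
qed

lemma lp_norm_nonneg: "0 \<le> lp_norm p x"
  by (simp add: lp_norm_def)

lemma lp_norm_powr:
  assumes "0 < p"
  shows "lp_norm p x powr p = (\<Sum>k\<in>UNIV. \<bar>x $ k\<bar> powr p)"
  using assms by (simp add: lp_norm_def powr_powr sum_nonneg)

lemma lp_norm_scaleR:
  assumes "0 < p"
  shows "lp_norm p (r *\<^sub>R x) = \<bar>r\<bar> * lp_norm p x"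
proof -
  have "(\<Sum>k\<in>UNIV. \<bar>(r *\<^sub>R x) $ k\<bar> powr p) = \<bar>r\<bar> powr p * (\<Sum>k\<in>UNIV. \<bar>x $ k\<bar> powr p)"
    by (simp add: abs_mult powr_mult sum_distrib_left)
  then show ?thesis
    using assms by (simp add: lp_norm_def powr_mult powr_powr sum_nonneg)
qed

lemma lp_norm_eq_0_imp:
  fixes x :: "real ^ 'n"
  assumes "0 < p" "lp_norm p x = 0"
  shows "x = 0"
proof -
  have "(\<Sum>k\<in>UNIV. \<bar>x $ k\<bar> powr p) = 0"
    using lp_norm_powr[OF assms(1), of x] assms by simp
  then have "\<forall>k. \<bar>x $ k\<bar> powr p = 0"
    by (subst (asm) sum_nonneg_eq_0_iff) auto
  then show ?thesis by (simp add: vec_eq_iff)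
qed

text \<open>
  Minkowski's inequality. With \<open>a\<close> and \<open>b\<close> the norms of \<open>x\<close> and \<open>y\<close>, the vector \<open>(x + y) / (a + b)\<close> is
  the convex combination of the unit vectors \<open>x / a\<close> and \<open>y / b\<close> with weights \<open>a / (a + b)\<close> and
  \<open>b / (a + b)\<close>; convexity of \<open>s \<mapsto> s\<^sup>p\<close> in each coordinate keeps it in the unit ball.
\<close>

lemma lp_norm_triangle:
  fixes x y :: "real ^ 'n"
  assumes "1 < p"
  shows "lp_norm p (x + y) \<le> lp_norm p x + lp_norm p y"
proof -
  define a b where "a = lp_norm p x" and "b = lp_norm p y"
  have "0 < p" using assms by simp
  consider "x = 0" | "y = 0" | "0 < a" "0 < b"
    using lp_norm_nonneg[of p x] lp_norm_nonneg[of p y] lp_norm_eq_0_imp[OF \<open>0 < p\<close>]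
    unfolding a_def b_def by (metis order_le_less)
  then show ?thesis
  proof cases
    case 3
    have coord: "\<bar>(x + y) $ k\<bar> powr p
        \<le> (a + b) powr p * (a / (a + b) * (\<bar>x $ k\<bar> powr p / a powr p)
                             + b / (a + b) * (\<bar>y $ k\<bar> powr p / b powr p))" for k
    proof -
      have "\<bar>(x + y) $ k\<bar> \<le> (a + b) * (a / (a + b) * (\<bar>x $ k\<bar> / a) + b / (a + b) * (\<bar>y $ k\<bar> / b))"
        using 3 by (simp add: distrib_left)
      then have "\<bar>(x + y) $ k\<bar> powr p
          \<le> ((a + b) * (a / (a + b) * (\<bar>x $ k\<bar> / a) + b / (a + b) * (\<bar>y $ k\<bar> / b))) powr p"
        using \<open>0 < p\<close> by (intro powr_mono2) auto
      also have "\<dots> = (a + b) powr p * (a / (a + b) * (\<bar>x $ k\<bar> / a) + b / (a + b) * (\<bar>y $ k\<bar> / b)) powr p"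
        using 3 by (intro powr_mult)
      also have "\<dots> \<le> (a + b) powr p * (a / (a + b) * (\<bar>x $ k\<bar> / a) powr p
                                          + b / (a + b) * (\<bar>y $ k\<bar> / b) powr p)"
        using 3 assms
        by (intro mult_left_mono powr_convex_combination) (auto simp: add_divide_distrib[symmetric])
      finally show ?thesis
        using 3 by (simp add: powr_divide)
    qed
    have "(\<Sum>k\<in>UNIV. \<bar>(x + y) $ k\<bar> powr p)
        \<le> (\<Sum>k\<in>UNIV. (a + b) powr p * (a / (a + b) * (\<bar>x $ k\<bar> powr p / a powr p)
                                          + b / (a + b) * (\<bar>y $ k\<bar> powr p / b powr p)))"
      by (intro sum_mono coord)
    also have "\<dots> = (a + b) powr p * (a / (a + b) * ((\<Sum>k\<in>UNIV. \<bar>x $ k\<bar> powr p) / a powr p)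
                                      + b / (a + b) * ((\<Sum>k\<in>UNIV. \<bar>y $ k\<bar> powr p) / b powr p))"
      by (simp only: sum_distrib_left[symmetric] sum.distrib sum_divide_distrib[symmetric])
    also have "\<dots> = (a + b) powr p * (a / (a + b) + b / (a + b))"
      using 3 by (simp add: lp_norm_powr[OF \<open>0 < p\<close>, symmetric] a_def[symmetric] b_def[symmetric])
    also have "\<dots> = (a + b) powr p"
      using 3 by (simp add: add_divide_distrib[symmetric])
    finally have "lp_norm p (x + y) powr p \<le> (a + b) powr p"
      using lp_norm_powr[OF \<open>0 < p\<close>, of "x + y"] by simp
    then have "lp_norm p (x + y) \<le> a + b"
      using \<open>0 < p\<close> 3 by (meson add_pos_pos not_le order_less_imp_le powr_less_mono2)
    then show ?thesis by (simp add: a_def b_def)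
  qed (use lp_norm_nonneg in auto)
qed

section \<open>Midpoint convexity of the loss\<close>

definition violation ::
  "real \<Rightarrow> real \<Rightarrow> ('i \<Rightarrow> real) \<Rightarrow> real ^ 'n \<Rightarrow> (real ^ 'n) ^ 'i \<Rightarrow> 'i \<Rightarrow> real" where
  "violation p \<theta> b x z i = \<theta> * lp_norm p x + x \<bullet> (z $ i) - b i"

definition loss ::
  "real \<Rightarrow> real \<Rightarrow> ('i \<Rightarrow> real) \<Rightarrow> real ^ 'n \<Rightarrow> (real ^ 'n) ^ 'i \<Rightarrow> real" where
  "loss p \<theta> b x z = (MAX i\<in>UNIV. max (violation p \<theta> b x z i) 0)"

definition separating ::
  "real \<Rightarrow> real \<Rightarrow> ('i \<Rightarrow> real) \<Rightarrow> real ^ 'n \<Rightarrow> real ^ 'n \<Rightarrow> ((real ^ 'n) ^ 'i) set" where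
  "separating p \<theta> b x y =
     {z. (\<exists>i. 0 < violation p \<theta> b x z i) \<and> (\<forall>i. violation p \<theta> b y z i < 0)}"

lemma alsox_objective_loss: "alsox_objective P p \<theta> b x = integral\<^sup>L P (loss p \<theta> b x)"
  by (simp add: alsox_objective_def loss_def[abs_def] violation_def)

lemma violation_le_loss:
  fixes b :: "'i::finite \<Rightarrow> real"
  shows "violation p \<theta> b x z i \<le> loss p \<theta> b x z"
proof -
  have "max (violation p \<theta> b x z i) 0 \<le> loss p \<theta> b x z"
    unfolding loss_def by (rule Max_ge) auto
  then show ?thesis by simp
qed

lemma loss_nonneg:
  fixes b :: "'i::finite \<Rightarrow> real"
  shows "0 \<le> loss p \<theta> b x z"
  unfolding loss_def by (subst Max_ge_iff) auto

lemma loss_attained: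
  fixes b :: "'i::finite \<Rightarrow> real"
  obtains i where "loss p \<theta> b x z = max (violation p \<theta> b x z i) 0"
proof -
  have "loss p \<theta> b x z \<in> range (\<lambda>i. max (violation p \<theta> b x z i) 0)"
    unfolding loss_def by (rule Max_in) auto
  then show thesis using that by auto
qed

lemma violation_midpoint:
  assumes "1 < p" "0 \<le> \<theta>"
  shows "violation p \<theta> b (midpoint x y) z i
    \<le> (violation p \<theta> b x z i + violation p \<theta> b y z i) / 2"
proof -
  have "lp_norm p (midpoint x y) = lp_norm p (x + y) / 2"
    using assms by (simp add: midpoint_def lp_norm_scaleR)
  also have "\<dots> \<le> (lp_norm p x + lp_norm p y) / 2"
    using lp_norm_triangle[OF assms(1), of x y] by simp
  finally have "\<theta> * lp_norm p (midpoint x y) \<le> \<theta> * ((lp_norm p x + lp_norm p y) / 2)"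
    using assms(2) by (rule mult_left_mono)
  then show ?thesis
    by (simp add: violation_def midpoint_def inner_add_left field_simps)
qed

lemma loss_midpoint:
  fixes b :: "'i::finite \<Rightarrow> real"
  assumes "1 < p" "0 \<le> \<theta>"
  shows "loss p \<theta> b (midpoint x y) z \<le> (loss p \<theta> b x z + loss p \<theta> b y z) / 2"
proof -
  obtain i where i: "loss p \<theta> b (midpoint x y) z = max (violation p \<theta> b (midpoint x y) z i) 0"
    by (rule loss_attained)
  show ?thesis
    using violation_midpoint[OF assms, of b x y z i] violation_le_loss[of p \<theta> b x z i]
      violation_le_loss[of p \<theta> b y z i] loss_nonneg[of p \<theta> b x z] loss_nonneg[of p \<theta> b y z]
    by (simp add: i)
qed

text \<open>
  In a scenario that separates \<open>x\<close> from \<open>y\<close>, the point \<open>y\<close> has loss zero although its violations are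
  strictly negative. These pull every violation of the midpoint strictly below half the loss of
  \<open>x\<close>, and half the loss of \<open>x\<close> is positive, so taking the positive part keeps the inequality strict.
\<close>

lemma loss_midpoint_strict:
  fixes b :: "'i::finite \<Rightarrow> real"
  assumes "1 < p" "0 \<le> \<theta>" "z \<in> separating p \<theta> b x y"
  shows "loss p \<theta> b (midpoint x y) z < (loss p \<theta> b x z + loss p \<theta> b y z) / 2"
proof -
  obtain i where i: "loss p \<theta> b (midpoint x y) z = max (violation p \<theta> b (midpoint x y) z i) 0"
    by (rule loss_attained)
  obtain j where "0 < violation p \<theta> b x z j"
    using assms(3) by (auto simp: separating_def)
  then have "0 < loss p \<theta> b x z"
    using violation_le_loss[of p \<theta> b x z j] by simp
  moreover have "violation p \<theta> b y z i < 0"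
    using assms(3) by (simp add: separating_def)
  ultimately show ?thesis
    using violation_midpoint[OF assms(1,2), of b x y z i] violation_le_loss[of p \<theta> b x z i]
      loss_nonneg[of p \<theta> b y z]
    by (simp add: i)
qed

lemma open_separating:
  fixes b :: "'i::finite \<Rightarrow> real"
  shows "open (separating p \<theta> b x y)"
  unfolding separating_def violation_def
  unfolding Collect_conj_eq Collect_ex_eq Collect_all_eq
  by (intro open_Int open_UN open_INT ballI open_Collect_less continuous_intros finite)

section \<open>Separating scenarios\<close>

text \<open>
  The vector \<open>w = \<parallel>y\<parallel> x - \<parallel>x\<parallel> y\<close> satisfies \<open>x \<bullet> w > 0 > y \<bullet> w\<close> by the strict Cauchy-Schwarz
  inequality. Putting a large multiple of \<open>w\<close> into every block dominates the constants \<open>b\<^sub>i\<close> and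
  the norm terms.
\<close>

lemma separating_not_same_ray:
  fixes b :: "'i::finite \<Rightarrow> real" and x y :: "real ^ 'n"
  assumes "norm x *\<^sub>R y \<noteq> norm y *\<^sub>R x"
  shows "separating p \<theta> b x y \<noteq> {}"
proof -
  define w where "w = norm y *\<^sub>R x - norm x *\<^sub>R y"
  have "x \<bullet> y < norm x * norm y"
    using assms norm_cauchy_schwarz[of x y] norm_cauchy_schwarz_eq[of x y] by linarith
  moreover have "0 < norm x" "0 < norm y"
    using assms by auto
  moreover have "x \<bullet> w = norm x * (norm x * norm y - x \<bullet> y)"
    "y \<bullet> w = - norm y * (norm x * norm y - x \<bullet> y)"
    by (simp_all add: w_def inner_diff_right inner_commute[of y x] power2_norm_eq_inner[symmetric]
        power2_eq_square algebra_simps)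
  ultimately have xw: "0 < x \<bullet> w" and yw: "y \<bullet> w < 0"
    by simp_all
  have large: "\<forall>\<^sub>F r in at_top. 0 < A + r * (x \<bullet> w)" "\<forall>\<^sub>F r in at_top. A + r * (y \<bullet> w) < 0" for A
    using xw yw by real_asymp+
  define z :: "real \<Rightarrow> (real ^ 'n) ^ 'i" where "z r = (\<chi> i. r *\<^sub>R w)" for r
  have "\<forall>\<^sub>F r in at_top. \<forall>i. 0 < violation p \<theta> b x (z r) i \<and> violation p \<theta> b y (z r) i < 0"
  proof (intro eventually_all_finite eventually_conj)
    fix i
    show "\<forall>\<^sub>F r in at_top. 0 < violation p \<theta> b x (z r) i"
      using large(1)[of "\<theta> * lp_norm p x - b i"] by (simp add: violation_def z_def algebra_simps)
    show "\<forall>\<^sub>F r in at_top. violation p \<theta> b y (z r) i < 0"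
      using large(2)[of "\<theta> * lp_norm p y - b i"] by (simp add: violation_def z_def algebra_simps)
  qed
  then obtain r where "\<forall>i. 0 < violation p \<theta> b x (z r) i \<and> violation p \<theta> b y (z r) i < 0"
    using eventually_happens'[OF trivial_limit_at_top_linorder] by blast
  then have "z r \<in> separating p \<theta> b x y"
    by (auto simp: separating_def)
  then show ?thesis by blast
qed

lemma loss_scaleR_homogeneous:
  fixes b :: "'i::finite \<Rightarrow> real"
  assumes "0 < p" "0 \<le> \<mu>" "\<And>i. b i = 0"
  shows "loss p \<theta> b (\<mu> *\<^sub>R x) z = \<mu> * loss p \<theta> b x z"
proof -
  have "violation p \<theta> b (\<mu> *\<^sub>R x) z i = \<mu> * violation p \<theta> b x z i" for i
    using assms by (simp add: violation_def lp_norm_scaleR algebra_simps)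
  then have "max (violation p \<theta> b (\<mu> *\<^sub>R x) z i) 0 = \<mu> * max (violation p \<theta> b x z i) 0" for i
    using assms(2) by (simp add: max_mult_distrib_left)
  then have "loss p \<theta> b (\<mu> *\<^sub>R x) z = Max ((*) \<mu> ` range (\<lambda>i. max (violation p \<theta> b x z i) 0))"
    by (simp add: loss_def image_image)
  also have "\<dots> = \<mu> * loss p \<theta> b x z"
    unfolding loss_def using assms(2)
    by (subst mono_Max_commute[symmetric]) (auto simp: mono_def mult_left_mono)
  finally show ?thesis .
qed

text \<open>
  On a common ray, the constraints decouple into the scalar pairs \<open>u\<^sub>i - b\<^sub>i\<close> and \<open>\<mu> u\<^sub>i - b\<^sub>i\<close>.
  For \<open>\<mu> > 0\<close> their zeros \<open>b\<^sub>i\<close> and \<open>b\<^sub>i / \<mu>\<close> differ whenever \<open>b\<^sub>i \<noteq> 0\<close>; strictly between them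
  the two signs are opposite, and very negative values of the other \<open>u\<^sub>j\<close> silence the remaining
  constraints. For \<open>\<mu> = 0\<close> the violations of the origin are the constants \<open>- b\<^sub>i\<close>: if one of them is
  positive, very negative \<open>u\<^sub>j\<close> separate, and otherwise the loss of the origin vanishes. If all
  \<open>b\<^sub>i\<close> are \<open>0\<close>, the loss is positively homogeneous.
\<close>

lemma separating_or_proportional_ray:
  fixes b :: "'i::finite \<Rightarrow> real" and x :: "real ^ 'n"
  assumes "0 < p" "x \<noteq> 0" "0 \<le> \<mu>" "\<mu> \<noteq> 1"
  shows "separating p \<theta> b x (\<mu> *\<^sub>R x) \<noteq> {} \<or> separating p \<theta> b (\<mu> *\<^sub>R x) x \<noteq> {} \<or>
    (\<forall>z. loss p \<theta> b (\<mu> *\<^sub>R x) z = \<mu> * loss p \<theta> b x z)"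
proof -
  have ex: "\<exists>z. \<forall>i. violation p \<theta> b x z i = u i - b i \<and> violation p \<theta> b (\<mu> *\<^sub>R x) z i = \<mu> * u i - b i"
    for u
  proof (intro exI allI conjI)
    define z where "z = (\<chi> i. ((u i - \<theta> * lp_norm p x) / (x \<bullet> x)) *\<^sub>R x)"
    have "x \<bullet> (z $ i) = u i - \<theta> * lp_norm p x" for i
      using \<open>x \<noteq> 0\<close> by (simp add: z_def)
    moreover have "violation p \<theta> b (\<mu> *\<^sub>R x) z i = \<mu> * (\<theta> * lp_norm p x + x \<bullet> (z $ i)) - b i" for i
      using assms by (simp add: violation_def lp_norm_scaleR algebra_simps)
    ultimately show "violation p \<theta> b x z i = u i - b i"
      "violation p \<theta> b (\<mu> *\<^sub>R x) z i = \<mu> * u i - b i" for i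
      by (simp_all add: violation_def)
  qed
  have sep: ?thesis if "(u i - b i) * (\<mu> * u i - b i) < 0"
    "\<And>j. j \<noteq> i \<Longrightarrow> u j - b j < 0 \<and> \<mu> * u j - b j < 0" for u i
  proof -
    obtain z where z: "\<And>i. violation p \<theta> b x z i = u i - b i"
        "\<And>i. violation p \<theta> b (\<mu> *\<^sub>R x) z i = \<mu> * u i - b i"
      using ex by blast
    have "z \<in> separating p \<theta> b x (\<mu> *\<^sub>R x) \<or> z \<in> separating p \<theta> b (\<mu> *\<^sub>R x) x"
      using that unfolding separating_def mem_Collect_eq z mult_less_0_iff by metis
    then show ?thesis by blast
  qed
  consider (homogeneous) "\<forall>i. b i = 0" | (origin) "\<mu> = 0" "\<forall>i. 0 \<le> b i"
    | (origin_infeasible) i where "\<mu> = 0" "b i < 0" | (positive) i where "0 < \<mu>" "b i \<noteq> 0"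
    using \<open>0 \<le> \<mu>\<close> by (metis not_le order_le_less)
  then show ?thesis
  proof cases
    case homogeneous
    then show ?thesis using loss_scaleR_homogeneous assms by blast
  next
    case origin
    have "violation p \<theta> b 0 z i \<le> 0" for z :: "(real ^ 'n) ^ 'i" and i
      using origin \<open>0 < p\<close> lp_norm_scaleR[of p 0 "0 :: real ^ 'n"] by (simp add: violation_def)
    then have "loss p \<theta> b 0 z = 0" for z :: "(real ^ 'n) ^ 'i"
      by (simp add: loss_def max_absorb2)
    then show ?thesis using origin by simp
  next
    case origin_infeasible
    obtain z where z: "\<And>j. violation p \<theta> b x z j = -1"
        "\<And>j. violation p \<theta> b (\<mu> *\<^sub>R x) z j = - b j"
      using ex[of "\<lambda>j. b j - 1"] \<open>\<mu> = 0\<close> by auto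
    then have "z \<in> separating p \<theta> b (\<mu> *\<^sub>R x) x"
      using \<open>b i < 0\<close> by (auto simp: separating_def intro: exI[of _ i])
    then show ?thesis by blast
  next
    case positive
    \<comment> \<open>the midpoint of the two zeros in block \<open>i\<close>, and a point below both zeros elsewhere\<close>
    define u where "u j = (if j = i then (b i + b i / \<mu>) / 2 else min (b j) (b j / \<mu>) - 1)" for j
    show ?thesis
    proof (rule sep[of u i])
      have "\<mu> * u i - b i = - \<mu> * (u i - b i)"
        using positive by (simp add: u_def field_simps)
      moreover have "u i - b i = b i * (1 - \<mu>) / (2 * \<mu>)"
        using positive by (simp add: u_def field_simps)
      then have "u i - b i \<noteq> 0"
        using positive \<open>\<mu> \<noteq> 1\<close> by simp
      ultimately show "(u i - b i) * (\<mu> * u i - b i) < 0"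
        using positive zero_less_mult_iff[of "u i - b i" "u i - b i"]
        by (simp add: mult.left_commute) (auto simp: zero_less_mult_iff)
    next
      fix j assume "j \<noteq> i"
      then have "u j < b j" "u j < b j / \<mu>"
        by (auto simp: u_def)
      then show "u j - b j < 0 \<and> \<mu> * u j - b j < 0"
        using positive by (simp add: pos_less_divide_eq mult.commute)
    qed
  qed
qed

text \<open>
  The conclusion has two cases because one of the points may be the origin, which is a multiple of
  the other point but not conversely.
\<close>

lemma separating_or_proportional:
  fixes b :: "'i::finite \<Rightarrow> real"
  assumes "0 < p" "x \<noteq> y" "separating p \<theta> b x y = {}" "separating p \<theta> b y x = {}"
  obtains \<mu> where "\<mu> \<noteq> 1" "\<forall>z. loss p \<theta> b y z = \<mu> * loss p \<theta> b x z"
    | \<mu> where "\<mu> \<noteq> 1" "\<forall>z. loss p \<theta> b x z = \<mu> * loss p \<theta> b y z"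
proof -
  have ray: "norm x *\<^sub>R y = norm y *\<^sub>R x"
    using separating_not_same_ray assms(3) by blast
  show thesis
  proof (cases "x = 0")
    case True
    then show thesis
      using that(2)[of 0] separating_or_proportional_ray[of p y 0 \<theta> b] assms by simp
  next
    case False
    define \<mu> where "\<mu> = norm y / norm x"
    have y: "y = \<mu> *\<^sub>R x"
      using ray False by (metis \<mu>_def divide_inverse_commute norm_eq_zero 
          scaleR_one scaleR_scaleR left_inverse)
    have "0 \<le> \<mu>"
      by (simp add: \<mu>_def)
    moreover have "\<mu> \<noteq> 1"
      using y \<open>x \<noteq> y\<close> by auto
    ultimately show thesis
      using that(1)[of \<mu>] separating_or_proportional_ray[of p x \<mu> \<theta> b] assms False y by simp
  qed
qed

section \<open>Uniqueness of the minimizer\<close>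

text \<open>
  Full support gives the open set of separating scenarios positive probability once it is nonempty,
  and then midpoint convexity is strict on average. Integrability of the losses comes from the
  hypotheses that their integrals are positive, since the integral of a nonintegrable function is \<open>0\<close>.
\<close>

lemma alsox_objective_midpoint_less:
  fixes b :: "'i::finite \<Rightarrow> real" and P :: "((real ^ 'n) ^ 'i) measure"
  assumes "1 < p" "0 \<le> \<theta>" "prob_space P" "sets P = sets borel" "topological_support P = UNIV"
    and "separating p \<theta> b x y \<noteq> {}"
    and pos: "0 < alsox_objective P p \<theta> b x" "0 < alsox_objective P p \<theta> b y"
      "0 < alsox_objective P p \<theta> b (midpoint x y)"
  shows "alsox_objective P p \<theta> b (midpoint x y)
    < (alsox_objective P p \<theta> b x + alsox_objective P p \<theta> b y) / 2"
proof -
  interpret prob_space P by fact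
  have int: "integrable P (loss p \<theta> b x)" "integrable P (loss p \<theta> b y)"
    "integrable P (loss p \<theta> b (midpoint x y))"
    using pos not_integrable_integral_eq unfolding alsox_objective_loss by fastforce+
  let ?S = "separating p \<theta> b x y"
  have "emeasure P ?S \<noteq> 0"
    using assms(5,6) open_separating[of p \<theta> b x y] unfolding topological_support_def by fastforce
  then have "integral\<^sup>L P (loss p \<theta> b (midpoint x y))
      < (\<integral>z. (loss p \<theta> b x z + loss p \<theta> b y z) / 2 \<partial>P)"
  proof (rule integral_less_AE[rotated 2])
    show "?S \<in> sets P"
      using open_separating[of p \<theta> b x y] assms(4) by simp
    show "AE z in P. z \<in> ?S \<longrightarrow>
        loss p \<theta> b (midpoint x y) z \<noteq> (loss p \<theta> b x z + loss p \<theta> b y z) / 2"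
      using loss_midpoint_strict[OF assms(1,2)] by (intro AE_I2) fastforce
    show "AE z in P. loss p \<theta> b (midpoint x y) z \<le> (loss p \<theta> b x z + loss p \<theta> b y z) / 2"
      using loss_midpoint[OF assms(1,2)] by (intro AE_I2) blast
  qed (use int in auto)
  then show ?thesis
    using int by (simp add: alsox_objective_loss)
qed

lemma alsox_feasible_nonempty:
  assumes "min_value (\<lambda>x. c \<bullet> x) X \<le> ereal t" "attains_min (\<lambda>x. c \<bullet> x) X"
  shows "alsox_feasible X c t \<noteq> {}"
proof (cases "bdd_below ((\<lambda>x. c \<bullet> x) ` X)")
  case True
  have "X \<noteq> {}"
    using assms(1) by (auto simp: min_value_def top_ereal_def)
  then obtain x where x: "x \<in> X" "\<And>y. y \<in> X \<Longrightarrow> c \<bullet> x \<le> c \<bullet> y"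
    using assms(2) True by (auto simp: attains_min_def is_arg_min_def not_less)
  then have "ereal (c \<bullet> x) \<le> min_value (\<lambda>x. c \<bullet> x) X"
    unfolding min_value_def by (intro INF_greatest) simp
  then have "c \<bullet> x \<le> t"
    using assms(1) by (metis ereal_less_eq(3) order_trans)
  then show ?thesis using x by (auto simp: alsox_feasible_def)
next
  case False
  then obtain x where "x \<in> X" "c \<bullet> x < t"
    by (auto simp: bdd_below_def not_le)
  then show ?thesis by (auto simp: alsox_feasible_def)
qed

theorem theorem7:
  fixes X :: "(real ^ 'n) set"
    and c :: "real ^ 'n"
    and b :: "'i::finite \<Rightarrow> real"
    and P :: "((real ^ 'n) ^ 'i) measure"
    and p \<theta> t :: real
  assumes "convex X"
    and "1 < p" and "0 \<le> \<theta>"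
    and "prob_space P" and "sets P = sets borel"
    and "sub_gaussian P"
    and "has_density P"
    and "nondegenerate P"
    and "topological_support P = UNIV"
    and "attains_min (\<lambda>x. c \<bullet> x) X"
    and "attains_min (alsox_objective P p \<theta> b) (alsox_feasible X c t)"
    and "min_value (\<lambda>x. c \<bullet> x) X \<le> ereal t"
    and "0 < alsox_value P p \<theta> b X c t"
  shows "\<exists>!x. is_arg_min (alsox_objective P p \<theta> b) (\<lambda>x. x \<in> alsox_feasible X c t) x"
proof -
  let ?f = "alsox_objective P p \<theta> b" and ?S = "alsox_feasible X c t"
  have pos: "0 < ?f x" if "x \<in> ?S" for x
  proof -
    have "alsox_value P p \<theta> b X c t \<le> ereal (?f x)"
      unfolding alsox_value_def min_value_def using that by (rule INF_lower)
    then have "ereal 0 < ereal (?f x)"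
      using assms(13) by (metis order_less_le_trans zero_ereal_def)
    then show ?thesis by simp
  qed
  have mid: "midpoint x y \<in> ?S" if "x \<in> ?S" "y \<in> ?S" for x y
  proof -
    have "?S = X \<inter> {x. c \<bullet> x \<le> t}"
      by (auto simp: alsox_feasible_def)
    then have "convex ?S"
      using convex_Int[OF \<open>convex X\<close> convex_halfspace_le[of c t]] by simp
    then show ?thesis
      using that midpoints_in_convex_hull[of x ?S y] by (simp add: hull_same)
  qed
  have no_separation: "separating p \<theta> b x y = {}"
    if "is_arg_min ?f (\<lambda>x. x \<in> ?S) x" "is_arg_min ?f (\<lambda>x. x \<in> ?S) y" for x y
  proof (rule ccontr)
    assume sep: "separating p \<theta> b x y \<noteq> {}"
    have S: "x \<in> ?S" "y \<in> ?S" and min: "\<And>w. w \<in> ?S \<Longrightarrow> ?f x \<le> ?f w" "\<And>w. w \<in> ?S \<Longrightarrow> ?f y \<le> ?f w"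
      using that by (auto simp: is_arg_min_def not_less)
    have "?f (midpoint x y) < (?f x + ?f y) / 2"
      using alsox_objective_midpoint_less[OF assms(2-5,9) sep] pos mid S by blast
    then show False
      using min[OF mid[OF S]] by simp
  qed
  show ?thesis
  proof (rule ex_ex1I)
    have "bdd_below (?f ` ?S)"
      using pos by (intro bdd_belowI2[of _ 0]) (auto intro: less_imp_le)
    then show "\<exists>x. is_arg_min ?f (\<lambda>x. x \<in> ?S) x"
      using assms(11) alsox_feasible_nonempty[OF assms(12,10)] by (simp add: attains_min_def)
  next
    fix x y
    assume arg_min: "is_arg_min ?f (\<lambda>x. x \<in> ?S) x" "is_arg_min ?f (\<lambda>x. x \<in> ?S) y"
    then have eq: "?f x = ?f y" and "0 < ?f x"
      using pos by (auto simp: is_arg_min_def not_less intro: antisym)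
    show "x = y"
    proof (rule ccontr)
      assume "x \<noteq> y"
      have "0 < p" using assms(2) by simp
      show False
      proof (rule separating_or_proportional[OF \<open>0 < p\<close> \<open>x \<noteq> y\<close>])
        show "separating p \<theta> b x y = {}" "separating p \<theta> b y x = {}"
          using no_separation arg_min by blast+
      next
        fix \<mu> :: real assume "\<mu> \<noteq> 1" "\<forall>z. loss p \<theta> b y z = \<mu> * loss p \<theta> b x z"
        then have "?f y = \<mu> * ?f x"
          by (simp add: alsox_objective_loss cong: Bochner_Integration.integral_cong)
        then show False
          using eq \<open>0 < ?f x\<close> \<open>\<mu> \<noteq> 1\<close> by simp
      next
        fix \<mu> :: real assume "\<mu> \<noteq> 1" "\<forall>z. loss p \<theta> b x z = \<mu> * loss p \<theta> b y z"
        then have "?f x = \<mu> * ?f y"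
          by (simp add: alsox_objective_loss cong: Bochner_Integration.integral_cong)
        then show False
          using eq \<open>0 < ?f x\<close> \<open>\<mu> \<noteq> 1\<close> by simp
      qed
    qed
  qed
qed

end
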